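(* Let $\mathbb{F}=\mathbb{R}$ or $\mathbb{C}$ and let $P=\{W_i\}_{i=1}^k$ be a fusion frame for $\mathbb{F}^n$ such that for every $1\le i,j\le k$ with $i\ne j$, one of the following conditions holds: (i) $W_i=W_j$; (ii) $W_i$ and $W_j$ are orthogonal to one another; or (iii) $W_i$ and $W_j$ are semi-orthogonal to one another. Let $Q$ be the canonical dual of $P$. Then $Q=P$ and $$\phi(P,Q)=FFP(P)=\sum_{i=1}^k\sum_{j=1}^k\dim(W_i\cap W_j).$$
   Context: A fusion frame for $\mathbb{F}^n$ is a finite sequence of subspaces $\{W_i\}_{i=1}^k$ for which there are constants $0<A\le B<\infty$ with $A\|f\|^2\le\sum_{i=1}^k\|P_if\|^2\le B\|f\|^2$ for all $f\in\mathbb{F}^n$, where $P_i$ is the orthogonal projection onto $W_i$; the fusion frame is identified with the sequence $\{P_i\}_{i=1}^k$. Its fusion frame operator is $S=\sum_{i=1}^kP_i$, and its canonical dual is the sequence of subspaces $\{S^{-1}W_i\}_{i=1}^k$ (identified with the sequence of orthogonal projections onto these subspaces). The fusion frame potential is $FFP(P)=\sum_{i=1}^k\sum_{j=1}^k\mathrm{Tr}(P_iP_j)$. The cross fusion frame potential of fusion frames $P=\{P_i\}_{i=1}^k$ and $Q=\{Q_i\}_{i=1}^k$ (given by orthogonal projections) is $\phi(P,Q)=\sum_{i=1}^k\sum_{j=1}^k\mathrm{Tr}(P_iQ_j)$. Two subspaces $W_1,W_2$ are semi-orthogonal if: (1) $W_1\cap W_2\ne\emptyset$; (2) there exists a non-trivial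 subspace $V_1\subset W_1$ such that $V_1$ is orthogonal to $W_2$ and $\dim(W_1\cap W_2)+\dim V_1=\dim W_1$; and (3) there exists a non-trivial subspace $V_2\subset W_2$ such that $V_2$ is orthogonal to $W_1$ and $\dim(W_1\cap W_2)+\dim V_2=\dim W_2$. *)

theory Defs
  imports "HOL-Analysis.Analysis" "Jordan_Normal_Form.Conjugate"
begin

text \<open>
  The space \<open>\<F>\<^sup>n\<close> is \<open>'a ^ 'n\<close> with \<open>'a\<close> being \<open>real\<close> or \<open>complex\<close>; its norm is the library's
  Euclidean norm. Subspace and dimension are \<open>vec.subspace\<close> and \<open>vec.dim\<close>, that is, taken over
  the scalar field \<open>'a\<close>. The library's \<open>\<bullet>\<close> and \<open>orthogonal\<close> on \<open>complex ^ 'n\<close> are only the real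
  part of the Hermitian structure, so the Hermitian inner product is introduced here; on
  \<open>real ^ 'n\<close>, where \<open>conjugate\<close> is the identity, it is the usual dot product.
  Operators on \<open>'a ^ 'n\<close> are given by their matrices.
\<close>

definition herm_inner :: "'a::conjugatable_field ^ 'n \<Rightarrow> 'a ^ 'n \<Rightarrow> 'a" where
  "herm_inner x y = (\<Sum>i\<in>UNIV. x $ i * conjugate (y $ i))"

definition orthogonal_subspaces :: "('a::conjugatable_field ^ 'n) set \<Rightarrow> ('a ^ 'n) set \<Rightarrow> bool" where
  "orthogonal_subspaces V W \<longleftrightarrow> (\<forall>v\<in>V. \<forall>w\<in>W. herm_inner v w = 0)"

definition orth_proj :: "('a::conjugatable_field ^ 'n) set \<Rightarrow> 'a ^ 'n ^ 'n" where
  "orth_proj W =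
    (THE P. \<forall>x. P *v x \<in> W \<and> (\<forall>w\<in>W. herm_inner (x - P *v x) w = 0))"

text \<open>Sequences of subspaces \<open>W\<^sub>1, \<dots>, W\<^sub>k\<close> are functions on \<open>nat\<close>, of which only the values on
  \<open>{1..k}\<close> matter.\<close>

definition fusion_frame ::
  "nat \<Rightarrow> (nat \<Rightarrow> ('a::{real_normed_field,conjugatable_field} ^ 'n) set) \<Rightarrow> bool" where
  "fusion_frame k W \<longleftrightarrow>
     (\<forall>i\<in>{1..k}. vec.subspace (W i)) \<and>
     (\<exists>A B :: real. 0 < A \<and> A \<le> B \<and>
        (\<forall>f. A * (norm f)\<^sup>2 \<le> (\<Sum>i=1..k. (norm (orth_proj (W i) *v f))\<^sup>2) \<and>
             (\<Sum>i=1..k. (norm (orth_proj (W i) *v f))\<^sup>2) \<le> B * (norm f)\<^sup>2))"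

definition fusion_frame_operator ::
  "nat \<Rightarrow> (nat \<Rightarrow> ('a::conjugatable_field ^ 'n) set) \<Rightarrow> 'a ^ 'n ^ 'n" where
  "fusion_frame_operator k W = (\<Sum>i=1..k. orth_proj (W i))"

definition canonical_dual ::
  "nat \<Rightarrow> (nat \<Rightarrow> ('a::conjugatable_field ^ 'n) set) \<Rightarrow> nat \<Rightarrow> ('a ^ 'n) set" where
  "canonical_dual k W i = (\<lambda>x. matrix_inv (fusion_frame_operator k W) *v x) ` W i"

definition fusion_frame_potential ::
  "nat \<Rightarrow> (nat \<Rightarrow> ('a::conjugatable_field ^ 'n) set) \<Rightarrow> 'a" where
  "fusion_frame_potential k W =
     (\<Sum>i=1..k. \<Sum>j=1..k. trace (orth_proj (W i) ** orth_proj (W j)))"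

definition cross_fusion_frame_potential ::
  "nat \<Rightarrow> (nat \<Rightarrow> ('a::conjugatable_field ^ 'n) set) \<Rightarrow> (nat \<Rightarrow> ('a ^ 'n) set) \<Rightarrow> 'a" where
  "cross_fusion_frame_potential k V W =
     (\<Sum>i=1..k. \<Sum>j=1..k. trace (orth_proj (V i) ** orth_proj (W j)))"

text \<open>The nonemptiness condition holds for any two subspaces. It is part of the original
  definition and is kept verbatim: the intersection may be the zero subspace.\<close>

definition semi_orthogonal :: "('a::conjugatable_field ^ 'n) set \<Rightarrow> ('a ^ 'n) set \<Rightarrow> bool" where
  "semi_orthogonal W1 W2 \<longleftrightarrow>
     W1 \<inter> W2 \<noteq> {} \<and>
     (\<exists>V1. vec.subspace V1 \<and> V1 \<noteq> {0} \<and> V1 \<subseteq> W1 \<and> orthogonal_subspaces V1 W2 \<and>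
        vec.dim (W1 \<inter> W2) + vec.dim V1 = vec.dim W1) \<and>
     (\<exists>V2. vec.subspace V2 \<and> V2 \<noteq> {0} \<and> V2 \<subseteq> W2 \<and> orthogonal_subspaces V2 W1 \<and>
        vec.dim (W1 \<inter> W2) + vec.dim V2 = vec.dim W2)"

end

theory Submission
  imports Defs
begin

text \<open>In each of the three cases \<open>W\<^sub>i\<close> splits orthogonally into \<open>W\<^sub>i \<inter> W\<^sub>j\<close> and a part orthogonal to
  \<open>W\<^sub>j\<close>, so \<open>P\<^sub>j\<close> maps \<open>W\<^sub>i\<close> into \<open>W\<^sub>i \<inter> W\<^sub>j\<close>. Hence \<open>P\<^sub>i P\<^sub>j\<close> is the orthogonal projection onto
  \<open>W\<^sub>i \<inter> W\<^sub>j\<close>, whose trace is its dimension. Moreover the injective operator \<open>S\<close> maps every \<open>W\<^sub>i\<close>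
  into itself, thus onto itself, so that \<open>S\<^sup>-\<^sup>1 W\<^sub>i = W\<^sub>i\<close>.\<close>

text \<open>Covers the real and the complex case at once. The axiom ties conjugation to the norm,
  which makes \<open>herm_inner\<close> positive definite.\<close>

class conjugatable_normed_field = real_normed_field + conjugatable_field +
  assumes mult_conjugate: "x * conjugate x = (norm x)\<^sup>2 *\<^sub>R 1"

instance real :: conjugatable_normed_field
  by standard (simp add: power2_eq_square)

instance complex :: conjugatable_normed_field
  by standard (simp add: complex_mult_cnj cmod_power2 scaleR_conv_of_real)

subsection \<open>The Hermitian inner product\<close>

lemma herm_inner_add_left: "herm_inner (x + y) z = herm_inner x z + herm_inner y z"
  by (simp add: herm_inner_def distrib_right sum.distrib)

lemma herm_inner_diff_left: "herm_inner (x - y) z = herm_inner x z - herm_inner y z"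
  by (simp add: herm_inner_def left_diff_distrib sum_subtractf)

lemma herm_inner_scale_left: "herm_inner (c *s x) z = c * herm_inner x z"
  by (simp add: herm_inner_def sum_distrib_left mult.assoc)

lemma herm_inner_add_right: "herm_inner z (x + y) = herm_inner z x + herm_inner z y"
  by (simp add: herm_inner_def distrib_left sum.distrib conjugate_dist_add)

lemma herm_inner_scale_right: "herm_inner z (c *s x) = conjugate c * herm_inner z x"
  by (simp add: herm_inner_def sum_distrib_left conjugate_dist_mul mult.left_commute)

lemma herm_inner_zero_left [simp]: "herm_inner 0 x = 0"
  by (simp add: herm_inner_def)

lemma herm_inner_zero_right [simp]: "herm_inner x 0 = 0"
  by (simp add: herm_inner_def)

lemma herm_inner_commute: "herm_inner y x = conjugate (herm_inner x y)"
  by (simp add: herm_inner_def sum_conjugate conjugate_dist_mul mult.commute)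

lemma herm_inner_self:
  fixes x :: "'a::conjugatable_normed_field ^ 'n"
  shows "herm_inner x x = of_real ((norm x)\<^sup>2)"
  by (simp add: herm_inner_def mult_conjugate norm_vec_def L2_set_def sum_nonneg scaleR_conv_of_real)

lemma herm_inner_self_eq_0_iff [simp]:
  fixes x :: "'a::conjugatable_normed_field ^ 'n"
  shows "herm_inner x x = 0 \<longleftrightarrow> x = 0"
  by (simp add: herm_inner_self)

lemma herm_inner_span_eq_0:
  fixes c :: "'a::conjugatable_field ^ 'n"
  assumes "\<And>b. b \<in> B \<Longrightarrow> herm_inner c b = 0" "w \<in> vec.span B"
  shows "herm_inner c w = 0"
  using assms(2)
proof (induction rule: vec.span_induct_alt)
  case base
  show ?case by simp
next
  case (step a b v)
  then show ?case by (simp add: herm_inner_add_right herm_inner_scale_right assms(1))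
qed

lemma orthogonal_subspaces_Int:
  fixes V W :: "('a::conjugatable_normed_field ^ 'n) set"
  assumes "orthogonal_subspaces V W"
  shows "V \<inter> W \<subseteq> {0}"
proof
  fix x
  assume "x \<in> V \<inter> W"
  then have "herm_inner x x = 0"
    using assms by (auto simp: orthogonal_subspaces_def)
  then show "x \<in> {0}" by simp
qed

subsection \<open>Orthogonal projections\<close>

text \<open>The property under the definite description in \<open>orth_proj\<close>, named so that
  existence and uniqueness can be settled before \<open>orth_proj\<close> is used.\<close>

definition is_orth_proj :: "('a::conjugatable_field ^ 'n) set \<Rightarrow> 'a ^ 'n ^ 'n \<Rightarrow> bool" where
  "is_orth_proj W P \<longleftrightarrow> (\<forall>x. P *v x \<in> W \<and> (\<forall>w\<in>W. herm_inner (x - P *v x) w = 0))"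

text \<open>As a difference of two residuals, \<open>p - q\<close> is orthogonal to
  \<open>W\<close>; it also lies in \<open>W\<close>, so it is orthogonal to itself. Working with a
  single vector allows a projection to be read off from an orthogonal decomposition.\<close>

lemma projection_unique:
  fixes x :: "'a::conjugatable_normed_field ^ 'n"
  assumes "vec.subspace W" "p \<in> W" "q \<in> W"
    and p: "\<And>w. w \<in> W \<Longrightarrow> herm_inner (x - p) w = 0"
    and q: "\<And>w. w \<in> W \<Longrightarrow> herm_inner (x - q) w = 0"
  shows "p = q"
proof -
  have "p - q \<in> W"
    using assms by (simp add: vec.subspace_diff)
  then have "herm_inner ((x - q) - (x - p)) (p - q) = 0"
    unfolding herm_inner_diff_left[of "x - q"] by (simp add: p q)
  then show ?thesis by simp
qed

lemma is_orth_proj_unique: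
  fixes P Q :: "'a::conjugatable_normed_field ^ 'n ^ 'n"
  assumes "vec.subspace W" "is_orth_proj W P" "is_orth_proj W Q"
  shows "P = Q"
  unfolding matrix_eq
  using assms projection_unique unfolding is_orth_proj_def by blast

text \<open>One Gram--Schmidt step: the projection gains the rank one summand \<open>c c\<^sup>* / \<parallel>c\<parallel>\<^sup>2\<close> of trace 1.\<close>

lemma orth_proj_span_exists:
  fixes B :: "('a::conjugatable_normed_field ^ 'n) set"
  assumes "finite B"
  shows "\<exists>P. is_orth_proj (vec.span B) P \<and> trace P = of_nat (vec.dim B)"
  using assms
proof (induction B)
  case empty
  have "is_orth_proj (vec.span {}) (0 :: 'a ^ 'n ^ 'n)"
    by (simp add: is_orth_proj_def)
  moreover have "trace (0 :: 'a ^ 'n ^ 'n) = of_nat (vec.dim ({} :: ('a ^ 'n) set))"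
    by (simp add: trace_0[unfolded mat_0])
  ultimately show ?case by blast
next
  case (insert b B)
  then obtain P where P: "is_orth_proj (vec.span B) P" and tr: "trace P = of_nat (vec.dim B)"
    by blast
  show ?case
  proof (cases "b \<in> vec.span B")
    case True
    then show ?thesis
      using P tr by (metis vec.dim_insert vec.span_redundant)
  next
    case False
    define c where "c = b - P *v b"
    define R :: "'a ^ 'n ^ 'n" where "R = (\<chi> i j. c $ i * conjugate (c $ j) / herm_inner c c)"
    have Pb: "P *v x \<in> vec.span B" and orth: "w \<in> vec.span B \<Longrightarrow> herm_inner (x - P *v x) w = 0" for x w
      using P by (auto simp: is_orth_proj_def)
    have "c \<noteq> 0"
      using False Pb[of b] by (auto simp: c_def)
    then have c0: "herm_inner c c \<noteq> 0" by simp
    have Rx: "R *v x = (herm_inner x c / herm_inner c c) *s c" for x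
      by (simp add: vec_eq_iff R_def matrix_vector_mult_def herm_inner_def[of x c]
          sum_distrib_left sum_divide_distrib sum_distrib_right mult_ac)
    have "is_orth_proj (vec.span (insert b B)) (P + R)"
      unfolding is_orth_proj_def
    proof (intro allI conjI ballI)
      fix x
      have sub: "vec.span B \<subseteq> vec.span (insert b B)"
        by (simp add: vec.span_mono subset_insertI)
      have "c \<in> vec.span (insert b B)"
        unfolding c_def using sub Pb[of b] by (intro vec.span_diff) (auto simp: vec.span_base)
      then show "(P + R) *v x \<in> vec.span (insert b B)"
        unfolding matrix_vector_mult_add_rdistrib Rx
        using sub Pb[of x] by (intro vec.span_add vec.span_scale) auto
    next
      fix x w
      assume w: "w \<in> vec.span (insert b B)"
      let ?r = "x - (P + R) *v x"
      have r: "?r = (x - P *v x) - (herm_inner x c / herm_inner c c) *s c"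
        by (simp add: matrix_vector_mult_add_rdistrib Rx)
      have r0: "herm_inner ?r v = 0" if "v \<in> vec.span B" for v
        using orth[OF that, of x] orth[OF that, of b]
        unfolding r by (simp add: herm_inner_diff_left herm_inner_scale_left c_def)
      \<comment> \<open>The coefficient in \<open>R *v x\<close> is formed from \<open>x\<close>
        instead of the residual \<open>x - P *v x\<close>; both give the same value because
        \<open>P *v x\<close> is orthogonal to \<open>c\<close>.\<close>
      have "herm_inner c (P *v x) = 0"
        using orth[OF Pb[of x], of b] by (simp add: c_def)
      then have "herm_inner (P *v x) c = 0"
        by (subst herm_inner_commute) simp
      then have "herm_inner ?r c = 0"
        unfolding r using c0 by (simp add: herm_inner_diff_left herm_inner_scale_left)
      \<comment> \<open>Passes from \<open>c\<close> back to the generator \<open>b\<close>, since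
        the other summand lies in the span of \<open>B\<close>.\<close>
      moreover have "b = c + P *v b"
        by (simp add: c_def)
      ultimately have "herm_inner ?r b = 0"
        using r0[OF Pb[of b]] by (metis herm_inner_add_right add_0)
      then show "herm_inner ?r w = 0"
        using r0 vec.span_base by (intro herm_inner_span_eq_0[OF _ w]) auto
    qed
    moreover have "trace R = 1"
      using c0 by (simp add: trace_def R_def herm_inner_def flip: sum_divide_distrib)
    then have "trace (P + R) = of_nat (vec.dim (insert b B))"
      using False by (simp add: trace_add tr vec.dim_insert)
    ultimately show ?thesis by blast
  qed
qed

text \<open>A finite spanning set yields some projection of the right trace, and uniqueness
  identifies it with \<open>orth_proj W\<close>.\<close>

lemma
  fixes W :: "('a::conjugatable_normed_field ^ 'n) set"
  assumes "vec.subspace W"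
  shows is_orth_proj_orth_proj: "is_orth_proj W (orth_proj W)"
    and trace_orth_proj: "trace (orth_proj W) = of_nat (vec.dim W)"
proof -
  obtain B where B: "finite B" "vec.span B = W"
    using vec.basis_subspace_exists[OF assms] by metis
  then obtain P where P: "is_orth_proj W P" and tr: "trace P = of_nat (vec.dim W)"
    using orth_proj_span_exists[OF B(1)] by (metis vec.dim_span)
  have "orth_proj W = P"
    unfolding orth_proj_def is_orth_proj_def[symmetric]
    using P is_orth_proj_unique[OF assms] by blast
  then show "is_orth_proj W (orth_proj W)" "trace (orth_proj W) = of_nat (vec.dim W)"
    using P tr by simp_all
qed

lemma orth_proj_eqI:
  fixes W :: "('a::conjugatable_normed_field ^ 'n) set"
  assumes "vec.subspace W" "is_orth_proj W P"
  shows "orth_proj W = P"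
  using assms is_orth_proj_orth_proj is_orth_proj_unique by blast

lemma
  fixes W :: "('a::conjugatable_normed_field ^ 'n) set"
  assumes "vec.subspace W"
  shows orth_proj_in: "orth_proj W *v x \<in> W"
    and orth_proj_orth: "w \<in> W \<Longrightarrow> herm_inner (x - orth_proj W *v x) w = 0"
  using is_orth_proj_orth_proj[OF assms] by (auto simp: is_orth_proj_def)

text \<open>The residual is orthogonal to the projected vector \<open>?p\<close>, so pairing
  \<open>?p\<close> with \<open>x\<close> amounts to pairing it with itself, up to a conjugation
  that fixes this value.\<close>

lemma herm_inner_orth_proj_self:
  fixes W :: "('a::conjugatable_normed_field ^ 'n) set"
  assumes "vec.subspace W"
  shows "herm_inner (orth_proj W *v x) x = of_real ((norm (orth_proj W *v x))\<^sup>2)"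
proof -
  let ?p = "orth_proj W *v x"
  have "herm_inner x ?p = herm_inner ?p ?p"
    using orth_proj_orth[OF assms orth_proj_in[OF assms], of x x]
    by (simp add: herm_inner_diff_left)
  then have "herm_inner ?p x = conjugate (herm_inner ?p ?p)"
    by (metis herm_inner_commute)
  also have "\<dots> = herm_inner ?p ?p"
    by (rule herm_inner_commute[symmetric])
  finally show ?thesis by (simp add: herm_inner_self)
qed

text \<open>The residual of the product is a sum of two residuals, one orthogonal to
  \<open>W\<close> and one orthogonal to \<open>V\<close>; both are therefore orthogonal to the
  intersection.\<close>

lemma orth_proj_mult_orth_proj:
  fixes V W :: "('a::conjugatable_normed_field ^ 'n) set"
  assumes V: "vec.subspace V" and W: "vec.subspace W"
    and maps: "\<And>w. w \<in> W \<Longrightarrow> orth_proj V *v w \<in> W"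
  shows "orth_proj V ** orth_proj W = orth_proj (V \<inter> W)"
proof (rule orth_proj_eqI[symmetric])
  show "vec.subspace (V \<inter> W)"
    using V W by (rule vec.subspace_inter)
  show "is_orth_proj (V \<inter> W) (orth_proj V ** orth_proj W)"
    unfolding is_orth_proj_def matrix_vector_mul_assoc[symmetric]
  proof (intro allI conjI ballI)
    fix x
    let ?y = "orth_proj W *v x"
    show "orth_proj V *v ?y \<in> V \<inter> W"
      using V W maps orth_proj_in by blast
    fix w
    assume "w \<in> V \<inter> W"
    then have "herm_inner (x - ?y) w = 0" "herm_inner (?y - orth_proj V *v ?y) w = 0"
      using V W orth_proj_orth by blast+
    then show "herm_inner (x - orth_proj V *v ?y) w = 0"
      by (simp add: herm_inner_diff_left)
  qed
qed

subsection \<open>Semi-orthogonal subspaces\<close>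

text \<open>A dimension count: \<open>V\<close> is orthogonal to \<open>W2\<close>, so it meets the
  intersection only in 0, and the sum of the two has the full dimension of
  \<open>W1\<close>.\<close>

lemma semi_orthogonal_decomp:
  fixes W1 W2 :: "('a::conjugatable_normed_field ^ 'n) set"
  assumes W: "vec.subspace W1" "vec.subspace W2" and "semi_orthogonal W1 W2" "w \<in> W1"
  obtains u v where "u \<in> W1 \<inter> W2" "\<And>z. z \<in> W2 \<Longrightarrow> herm_inner v z = 0" "w = u + v"
proof -
  obtain V where V: "vec.subspace V" "V \<subseteq> W1" "orthogonal_subspaces V W2"
    and dim: "vec.dim (W1 \<inter> W2) + vec.dim V = vec.dim W1"
    using assms(3) unfolding semi_orthogonal_def by blast
  let ?U = "W1 \<inter> W2"
  let ?S = "{x + y |x y. x \<in> ?U \<and> y \<in> V}"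
  have U: "vec.subspace ?U"
    using W by (rule vec.subspace_inter)
  have "?U \<inter> V \<subseteq> {0}"
    using orthogonal_subspaces_Int[OF V(3)] by blast
  then have "vec.dim (?U \<inter> V) = 0"
    by (simp only: vec.dim_eq_0)
  then have "vec.dim ?S = vec.dim W1"
    using vec.dim_sums_Int[OF U V(1)] dim by linarith
  moreover have "?S \<subseteq> W1"
    using V(2) W(1) by (auto intro!: vec.subspace_add)
  ultimately have "?S = W1"
    using vec.subspace_dim_equal[OF vec.subspace_sums[OF U V(1)] W(1)] by simp
  then obtain u v where "u \<in> ?U" "v \<in> V" "w = u + v"
    using \<open>w \<in> W1\<close> by blast
  then show ?thesis
    using that V(3) unfolding orthogonal_subspaces_def by blast
qed

lemma orth_proj_maps_into:
  fixes V W :: "('a::conjugatable_normed_field ^ 'n) set"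
  assumes V: "vec.subspace V" and W: "vec.subspace W"
    and rel: "V = W \<or> orthogonal_subspaces W V \<or> semi_orthogonal W V"
    and w: "w \<in> W"
  shows "orth_proj V *v w \<in> W"
proof -
  obtain u v where u: "u \<in> W \<inter> V" and v: "\<And>z. z \<in> V \<Longrightarrow> herm_inner v z = 0" and "w = u + v"
    using rel
  proof (elim disjE)
    assume "V = W"
    then show ?thesis using that[of w 0] w by simp
  next
    assume "orthogonal_subspaces W V"
    then show ?thesis
      using that[of 0 w] w V W by (simp add: orthogonal_subspaces_def vec.subspace_0)
  next
    assume "semi_orthogonal W V"
    then show ?thesis
      by (rule semi_orthogonal_decomp[OF W V _ w]) (rule that)
  qed
  \<comment> \<open>\<open>u\<close> lies in \<open>V\<close> and \<open>w - u = v\<close> is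
    orthogonal to \<open>V\<close>, which characterizes the projection of \<open>w\<close>.\<close>
  then have "orth_proj V *v w = u"
    using V by (intro projection_unique[of V _ _ w]) (auto simp: orth_proj_in orth_proj_orth)
  then show ?thesis using u by simp
qed

subsection \<open>The fusion frame operator\<close>

lemma fusion_frame_operator_mult_vec:
  fixes W :: "nat \<Rightarrow> ('a::conjugatable_field ^ 'n) set"
  shows "fusion_frame_operator k W *v x = (\<Sum>i=1..k. orth_proj (W i) *v x)"
proof -
  have "(\<Sum>i\<in>I. M i) *v x = (\<Sum>i\<in>I. M i *v x)" if "finite I"
    for I :: "nat set" and M :: "nat \<Rightarrow> 'a ^ 'n ^ 'n"
    using that by induction (simp_all add: matrix_vector_mult_add_rdistrib)
  then show ?thesis by (simp add: fusion_frame_operator_def)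
qed

text \<open>Pairing \<open>S x\<close> with \<open>x\<close> gives the sum of the squared norms of
  the projections of \<open>x\<close>, which the lower frame bound keeps above a positive multiple
  of the squared norm of \<open>x\<close>.\<close>

lemma fusion_frame_operator_eq_0D:
  fixes W :: "nat \<Rightarrow> ('a::conjugatable_normed_field ^ 'n) set"
  assumes "fusion_frame k W" "fusion_frame_operator k W *v x = 0"
  shows "x = 0"
proof -
  have sub: "vec.subspace (W i)" if "i \<in> {1..k}" for i
    using assms(1) that by (simp add: fusion_frame_def)
  have sum_left: "herm_inner (\<Sum>i\<in>I. f i) x = (\<Sum>i\<in>I. herm_inner (f i) x)" if "finite I"
    for I :: "nat set" and f
    using that by induction (simp_all add: herm_inner_add_left)
  have "of_real (\<Sum>i=1..k. (norm (orth_proj (W i) *v x))\<^sup>2)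
      = herm_inner (fusion_frame_operator k W *v x) x"
    unfolding fusion_frame_operator_mult_vec sum_left[OF finite_atLeastAtMost] of_real_sum
    by (intro sum.cong refl herm_inner_orth_proj_self[symmetric] sub)
  also have "\<dots> = 0" by (simp add: assms(2))
  finally have "(\<Sum>i=1..k. (norm (orth_proj (W i) *v x))\<^sup>2) = 0"
    by (simp only: of_real_eq_0_iff)
  moreover obtain A :: real where "0 < A"
    "A * (norm x)\<^sup>2 \<le> (\<Sum>i=1..k. (norm (orth_proj (W i) *v x))\<^sup>2)"
    using assms(1) unfolding fusion_frame_def by blast
  ultimately have "A * (norm x)\<^sup>2 \<le> 0" by linarith
  then show ?thesis
    using \<open>0 < A\<close> by (simp add: mult_le_0_iff)
qed

text \<open>A trivial kernel gives a left inverse, which is two-sided for a square matrix, so the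
  choice in \<open>matrix_inv\<close> has a witness.\<close>

lemma matrix_inv_mult_vec:
  fixes M :: "'a::field ^ 'n ^ 'n"
  assumes "\<And>x. M *v x = 0 \<Longrightarrow> x = 0"
  shows "matrix_inv M *v (M *v x) = x"
proof -
  obtain B where "B ** M = mat 1"
    using matrix_left_invertible_ker[of M] assms by metis
  then have "M ** B = mat 1 \<and> B ** M = mat 1"
    by (simp add: matrix_left_right_inverse)
  then have "\<exists>B. M ** B = mat 1 \<and> B ** M = mat 1" ..
  then have "matrix_inv M ** M = mat 1"
    unfolding matrix_inv_def by (rule someI2_ex) simp
  then show ?thesis
    by (simp add: matrix_vector_mul_assoc)
qed

lemma canonical_dual_eq:
  fixes W :: "nat \<Rightarrow> ('a::conjugatable_normed_field ^ 'n) set"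
  assumes frame: "fusion_frame k W" and i: "vec.subspace (W i)"
    and maps: "\<And>j w. j \<in> {1..k} \<Longrightarrow> w \<in> W i \<Longrightarrow> orth_proj (W j) *v w \<in> W i"
  shows "canonical_dual k W i = W i"
proof -
  let ?S = "fusion_frame_operator k W"
  have inv: "matrix_inv ?S *v (?S *v x) = x" for x
    by (rule matrix_inv_mult_vec[OF fusion_frame_operator_eq_0D[OF frame]])
  have lin: "Vector_Spaces.linear (*s) (*s) ((*v) ?S)"
    by (rule matrix_vector_mul_linear_gen)
  have "inj_on ((*v) ?S) (vec.span (W i))"
    by (metis inj_onI inv)
  then have "vec.dim ((*v) ?S ` W i) = vec.dim (W i)"
    using lin by (rule vec.dim_image_eq[rotated])
  moreover have "(*v) ?S ` W i \<subseteq> W i"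
    unfolding fusion_frame_operator_mult_vec by (auto intro!: vec.subspace_sum[OF i] maps)
  ultimately have "(*v) ?S ` W i = W i"
    using i vec.linear_subspace_image[OF lin i] by (intro vec.subspace_dim_equal) simp_all
  \<comment> \<open>Writing \<open>W i\<close> as its own image under \<open>?S\<close> lets the
    inverse cancel pointwise.\<close>
  then have "canonical_dual k W i = (*v) (matrix_inv ?S) ` (*v) ?S ` W i"
    by (simp add: canonical_dual_def)
  then show ?thesis by (simp add: image_image inv)
qed

lemma canonical_dual_semi_orthogonal:
  fixes W :: "nat \<Rightarrow> ('a::conjugatable_normed_field ^ 'n) set"
  assumes frame: "fusion_frame k W"
    and rel: "\<forall>i\<in>{1..k}. \<forall>j\<in>{1..k}. i \<noteq> j \<longrightarrow>
      W i = W j \<or> orthogonal_subspaces (W i) (W j) \<or> semi_orthogonal (W i) (W j)"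
  shows "(\<forall>i\<in>{1..k}. canonical_dual k W i = W i) \<and>
    cross_fusion_frame_potential k W (canonical_dual k W) = fusion_frame_potential k W \<and>
    fusion_frame_potential k W = of_nat (\<Sum>i=1..k. \<Sum>j=1..k. vec.dim (W i \<inter> W j))"
proof (intro conjI)
  have sub: "vec.subspace (W i)" if "i \<in> {1..k}" for i
    using frame that by (simp add: fusion_frame_def)
  have maps: "orth_proj (W j) *v w \<in> W i" if "i \<in> {1..k}" "j \<in> {1..k}" "w \<in> W i" for i j w
  proof (rule orth_proj_maps_into)
    \<comment> \<open>The hypothesis concerns distinct indices only; equal ones fall under the first
      alternative.\<close>
    have "W i = W j \<or> orthogonal_subspaces (W i) (W j) \<or> semi_orthogonal (W i) (W j)"
      using rel that(1,2) by (cases "i = j") blast+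
    then show "W j = W i \<or> orthogonal_subspaces (W i) (W j) \<or> semi_orthogonal (W i) (W j)"
      by (elim disjE) simp_all
  qed (use that sub in auto)
  show dual: "\<forall>i\<in>{1..k}. canonical_dual k W i = W i"
    by (intro ballI canonical_dual_eq[OF frame] sub maps)
  then show "cross_fusion_frame_potential k W (canonical_dual k W) = fusion_frame_potential k W"
    by (simp add: cross_fusion_frame_potential_def fusion_frame_potential_def)
  have "trace (orth_proj (W i) ** orth_proj (W j)) = of_nat (vec.dim (W i \<inter> W j))"
    if "i \<in> {1..k}" "j \<in> {1..k}" for i j
  proof -
    \<comment> \<open>Here \<open>W j\<close> must be invariant under the projection onto
      \<open>W i\<close>, which is \<open>maps\<close> with the indices exchanged.\<close>
    have "orth_proj (W i) ** orth_proj (W j) = orth_proj (W i \<inter> W j)"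
      using that by (intro orth_proj_mult_orth_proj sub maps)
    then show ?thesis
      using that by (simp add: trace_orth_proj sub vec.subspace_inter)
  qed
  then show "fusion_frame_potential k W = of_nat (\<Sum>i=1..k. \<Sum>j=1..k. vec.dim (W i \<inter> W j))"
    by (simp add: fusion_frame_potential_def)
qed

theorem theorem46:
  shows
    "(\<forall>(k::nat) (W :: nat \<Rightarrow> (real ^ 'n) set).
        fusion_frame k W \<and>
        (\<forall>i\<in>{1..k}. \<forall>j\<in>{1..k}. i \<noteq> j \<longrightarrow>
           W i = W j \<or> orthogonal_subspaces (W i) (W j) \<or> semi_orthogonal (W i) (W j))
        \<longrightarrow>
        (\<forall>i\<in>{1..k}. canonical_dual k W i = W i) \<and>
        cross_fusion_frame_potential k W (canonical_dual k W) = fusion_frame_potential k W \<and>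
        fusion_frame_potential k W = of_nat (\<Sum>i=1..k. \<Sum>j=1..k. vec.dim (W i \<inter> W j)))
     \<and>
     (\<forall>(k::nat) (W :: nat \<Rightarrow> (complex ^ 'n) set).
        fusion_frame k W \<and>
        (\<forall>i\<in>{1..k}. \<forall>j\<in>{1..k}. i \<noteq> j \<longrightarrow>
           W i = W j \<or> orthogonal_subspaces (W i) (W j) \<or> semi_orthogonal (W i) (W j))
        \<longrightarrow>
        (\<forall>i\<in>{1..k}. canonical_dual k W i = W i) \<and>
        cross_fusion_frame_potential k W (canonical_dual k W) = fusion_frame_potential k W \<and>
        fusion_frame_potential k W = of_nat (\<Sum>i=1..k. \<Sum>j=1..k. vec.dim (W i \<inter> W j)))"
  \<comment> \<open>Both scalar fields are instances of
    \<open>conjugatable_normed_field\<close>.\<close>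
  by (rule conjI; intro allI impI; elim conjE; rule canonical_dual_semi_orthogonal; assumption)

end
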